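(* Let $k\ge1$ be an integer and let $0<c<1$ be a constant. For any graph $G$ of order $n$ with minimum degree $\delta$ satisfying $k\le(1-c)\ln\delta$, $$\gamma_{\times k}(G)<\left(\frac{\ln\delta}{\delta+1}+\frac{k}{\delta^{0.5c^2}}\right)n\le\frac{(1-c)\ln\delta}{\delta^{0.5c^2}}\,n\,(1+o_\delta(1)),$$ where $o_\delta(1)$ denotes a quantity tending to $0$ as $\delta\to\infty$ (with $c$ fixed).
   Context: All graphs are finite, undirected, without loops and multiple edges (and nonempty). $N[v]$ denotes the closed neighbourhood of $v$ (the neighbours of $v$ together with $v$). A set $X\subseteq V(G)$ is a $k$-tuple dominating set of $G$ if $|N[v]\cap X|\ge k$ for every vertex $v\in V(G)$. The $k$-tuple domination number $\gamma_{\times k}(G)$ is the minimum cardinality of a $k$-tuple dominating set of $G$; it is defined for graphs with minimum degree at least $k-1$. *)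

theory Defs
  imports "HOL-Analysis.Analysis" "Graph_Theory.Pair_Digraph"
begin

text \<open>
  A finite simple graph is a \<open>pair_graph\<close>: finite vertex set \<open>pverts G\<close>, and a symmetric,
  irreflexive arc relation \<open>parcs G\<close> in which an edge \<open>{u, v}\<close> is the pair of arcs
  \<open>(u, v)\<close>, \<open>(v, u)\<close>. Hence the degree of a vertex is its \<open>out_degree\<close>.
\<close>

definition closed_nbhd :: "'a pair_pre_digraph \<Rightarrow> 'a \<Rightarrow> 'a set" where
  "closed_nbhd G v = insert v {u. (v, u) \<in> parcs G}"

text \<open>Meaningful for finite nonempty graphs only.\<close>
definition min_degree :: "'a pair_pre_digraph \<Rightarrow> nat" where
  "min_degree G = Min (out_degree (with_proj G) ` pverts G)"

definition tuple_dominating_set :: "nat \<Rightarrow> 'a pair_pre_digraph \<Rightarrow> 'a set \<Rightarrow> bool" where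
  "tuple_dominating_set k G X \<longleftrightarrow>
     X \<subseteq> pverts G \<and> (\<forall>v\<in>pverts G. k \<le> card (closed_nbhd G v \<inter> X))"

text \<open>
  Meaningful when some \<open>k\<close>-tuple dominating set exists, that is, when the minimum degree of the
  graph is at least \<open>k - 1\<close>; otherwise the value is unspecified.
\<close>
definition tuple_domination_number :: "nat \<Rightarrow> 'a pair_pre_digraph \<Rightarrow> nat" where
  "tuple_domination_number k G = (LEAST m. \<exists>X. tuple_dominating_set k G X \<and> card X = m)"

end

theory Submission
  imports Defs "HOL-Real_Asymp.Real_Asymp"
begin

text \<open>
  The first inequality is an alteration argument. Put every vertex into a random set \<open>X\<close>
  independently with probability \<open>p = ln \<delta> / (\<delta> + 1)\<close>, so that \<open>X\<close> has mean size \<open>p n\<close> and meets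
  each closed neighbourhood in at least \<open>ln \<delta>\<close> vertices on average. A vertex \<open>v\<close> for which
  \<open>N[v] \<inter> X\<close> has fewer than \<open>k\<close> elements is repaired by adding \<open>k\<close> vertices of \<open>N[v]\<close>. Since
  \<open>k \<le> (1 - c) ln \<delta>\<close>, such a \<open>v\<close> is a lower-tail event, with probability less than \<open>\<delta>\<close> to the power
  \<open>-c\<^sup>2/2\<close> by Chernoff's bound, and the expected cost of all repairs is below \<open>k n\<close> times this
  power. Some outcome is at least as good as the mean.

  The tail bound comes from the generating function
  \<open>E (z ^ card (N \<inter> X)) = (1 - p + p z) ^ card N\<close> (\<open>bernoulli_mean_power_card_inter\<close>), because
  \<open>z ^ card (N \<inter> X) / z ^ k\<close> with \<open>0 < z \<le> 1\<close> is at least \<open>1\<close> whenever the intersection has at most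
  \<open>k\<close> elements. This yields \<open>exists_small_multicover\<close>, a statement about arbitrary finite set
  systems. The choice \<open>z = 1 - c\<close> leads to the exponent \<open>c + (1 - c) ln (1 - c)\<close>, which is at
  least \<open>c\<^sup>2/2\<close> (\<open>chernoff_exponent_ge\<close>). The inequality is strict because
  \<open>1 - p c < exp (- p c)\<close>.

  For the second inequality, \<open>k\<close> is replaced by its upper bound; the quotient of the two terms of
  the resulting sum is \<open>\<delta>\<close> to the power \<open>c\<^sup>2/2\<close>, divided by \<open>(1 - c) (\<delta> + 1)\<close>, which tends to \<open>0\<close>
  because \<open>c\<^sup>2/2 < 1\<close>.
\<close>

section \<open>Means over random subsets\<close>

text \<open>
  The expectation of \<open>f\<close> over a random subset of \<open>V\<close> that contains each element independently with
  probability \<open>p\<close>.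
\<close>
definition bernoulli_mean :: "'a set \<Rightarrow> real \<Rightarrow> ('a set \<Rightarrow> real) \<Rightarrow> real" where
  "bernoulli_mean V p f = (\<Sum>X\<in>Pow V. p ^ card X * (1 - p) ^ card (V - X) * f X)"

lemma bernoulli_mean_add:
  "bernoulli_mean V p (\<lambda>X. f X + g X) = bernoulli_mean V p f + bernoulli_mean V p g"
  by (simp add: bernoulli_mean_def algebra_simps sum.distrib)

lemma bernoulli_mean_diff:
  "bernoulli_mean V p (\<lambda>X. f X - g X) = bernoulli_mean V p f - bernoulli_mean V p g"
  by (simp add: bernoulli_mean_def algebra_simps sum_subtractf)

lemma bernoulli_mean_cmult:
  "bernoulli_mean V p (\<lambda>X. a * f X) = a * bernoulli_mean V p f"
  by (simp add: bernoulli_mean_def sum_distrib_left mult_ac)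

lemma bernoulli_mean_sum:
  "bernoulli_mean V p (\<lambda>X. \<Sum>i\<in>I. f i X) = (\<Sum>i\<in>I. bernoulli_mean V p (f i))"
  unfolding bernoulli_mean_def sum_distrib_left by (rule sum.swap)

text \<open>
  The binomial expansion of a product over \<open>V\<close> whose factor at \<open>x\<close> is \<open>p z + (1 - p)\<close> if \<open>x\<close> lies
  in \<open>N\<close> and \<open>p + (1 - p) = 1\<close> otherwise.
\<close>
lemma bernoulli_mean_power_card_inter:
  assumes "finite V" and "N \<subseteq> V"
  shows "bernoulli_mean V p (\<lambda>X. z ^ card (N \<inter> X)) = (1 - p + p * z) ^ card N"
proof -
  have "(\<Prod>x\<in>V. p * (if x \<in> N then z else 1) + (1 - p))
      = (\<Sum>X\<in>Pow V. (\<Prod>x\<in>X. p * (if x \<in> N then z else 1)) * (\<Prod>x\<in>V-X. 1 - p))"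
    by (rule prod_add[OF assms(1)])
  also have "\<dots> = bernoulli_mean V p (\<lambda>X. z ^ card (N \<inter> X))"
    unfolding bernoulli_mean_def
  proof (rule sum.cong[OF refl])
    fix X assume "X \<in> Pow V"
    then have "finite X" using assms(1) finite_subset by auto
    then have "(\<Prod>x\<in>X. p * (if x \<in> N then z else 1)) = p ^ card X * z ^ card (N \<inter> X)"
      by (simp add: prod.distrib prod.If_cases Int_commute)
    then show "(\<Prod>x\<in>X. p * (if x \<in> N then z else 1)) * (\<Prod>x\<in>V-X. 1 - p)
        = p ^ card X * (1 - p) ^ card (V - X) * z ^ card (N \<inter> X)"
      by simp
  qed
  also have "(\<Prod>x\<in>V. p * (if x \<in> N then z else 1) + (1 - p))
      = (\<Prod>x\<in>V. if x \<in> N then 1 - p + p * z else 1)"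
    by (rule prod.cong) auto
  also have "\<dots> = (1 - p + p * z) ^ card N"
    using assms by (simp add: prod.If_cases Int_absorb1)
  finally show ?thesis by simp
qed

lemma bernoulli_mean_const:
  assumes "finite V"
  shows "bernoulli_mean V p (\<lambda>X. a) = a"
  using bernoulli_mean_power_card_inter[OF assms, of "{}" p 1]
    bernoulli_mean_cmult[of V p a "\<lambda>X. 1"] by simp

text \<open>
  The indicator of \<open>x \<in> X\<close> is \<open>1 - 0 ^ card ({x} \<inter> X)\<close>, so the mean of each indicator is the value
  of the generating function at \<open>z = 0\<close>.
\<close>
lemma bernoulli_mean_card:
  assumes "finite V"
  shows "bernoulli_mean V p (\<lambda>X. real (card X)) = p * real (card V)"
proof -
  have "bernoulli_mean V p (\<lambda>X. real (card X))
      = bernoulli_mean V p (\<lambda>X. \<Sum>x\<in>V. 1 - 0 ^ card ({x} \<inter> X))"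
    unfolding bernoulli_mean_def
  proof (rule sum.cong[OF refl])
    fix X assume X: "X \<in> Pow V"
    have "(\<Sum>x\<in>V. 1 - 0 ^ card ({x} \<inter> X)) = (\<Sum>x\<in>V. if x \<in> X then 1 else (0::real))"
      by (rule sum.cong) auto
    also have "\<dots> = real (card X)"
      using X assms by (simp add: sum.If_cases Int_absorb1)
    finally show "p ^ card X * (1 - p) ^ card (V - X) * real (card X)
        = p ^ card X * (1 - p) ^ card (V - X) * (\<Sum>x\<in>V. 1 - 0 ^ card ({x} \<inter> X))"
      by simp
  qed
  also have "\<dots> = (\<Sum>x\<in>V. bernoulli_mean V p (\<lambda>X. 1 - 0 ^ card ({x} \<inter> X)))"
    by (rule bernoulli_mean_sum)
  also have "\<dots> = (\<Sum>x\<in>V. p)"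
  proof (rule sum.cong[OF refl])
    fix x assume "x \<in> V"
    then show "bernoulli_mean V p (\<lambda>X. 1 - 0 ^ card ({x} \<inter> X)) = p"
      using bernoulli_mean_power_card_inter[OF assms, of "{x}" p 0]
      by (simp add: bernoulli_mean_diff bernoulli_mean_const[OF assms])
  qed
  finally show ?thesis by (simp add: mult.commute)
qed

lemma exists_le_bernoulli_mean:
  assumes "finite V" and "0 \<le> p" and "p \<le> 1"
  obtains X where "X \<subseteq> V" and "f X \<le> bernoulli_mean V p f"
proof -
  let ?m = "Min (f ` Pow V)"
  have fin: "finite (f ` Pow V)" and ne: "f ` Pow V \<noteq> {}" using assms(1) by auto
  have "bernoulli_mean V p (\<lambda>X. ?m) \<le> bernoulli_mean V p f"
    unfolding bernoulli_mean_def
    using assms fin by (intro sum_mono mult_left_mono Min_le) auto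
  then have "?m \<le> bernoulli_mean V p f"
    by (simp add: bernoulli_mean_const[OF assms(1)])
  moreover have "?m \<in> f ` Pow V" using Min_in[OF fin ne] .
  ultimately show ?thesis using that by (metis PowD imageE)
qed

section \<open>Small multiple covers of set systems\<close>

lemma repair_deficient_sets:
  assumes "finite I" and "finite V" and "X \<subseteq> V"
    and sub: "\<And>i. i \<in> I \<Longrightarrow> N i \<subseteq> V" and big: "\<And>i. i \<in> I \<Longrightarrow> k \<le> card (N i)"
  obtains Y where "Y \<subseteq> V" and "\<And>i. i \<in> I \<Longrightarrow> k \<le> card (N i \<inter> Y)"
    and "card Y \<le> card X + k * card {i \<in> I. card (N i \<inter> X) < k}"
proof -
  define D where "D = {i \<in> I. card (N i \<inter> X) < k}"
  have "\<exists>S. S \<subseteq> N i \<and> card S = k" if "i \<in> D" for i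
    using big[of i] that obtain_subset_with_card_n[of k "N i"] by (auto simp: D_def)
  then obtain S where S: "\<And>i. i \<in> D \<Longrightarrow> S i \<subseteq> N i \<and> card (S i) = k"
    by metis
  define Y where "Y = X \<union> (\<Union>i\<in>D. S i)"
  have YV: "Y \<subseteq> V" using S sub assms(3) by (force simp: Y_def D_def)
  have finY: "finite Y" using YV assms(2) by (rule finite_subset)
  have "k \<le> card (N i \<inter> Y)" if i: "i \<in> I" for i
  proof (cases "i \<in> D")
    case True
    then have "S i \<subseteq> N i \<inter> Y" using S by (auto simp: Y_def)
    then have "card (S i) \<le> card (N i \<inter> Y)" using finY by (intro card_mono) auto
    then show ?thesis using S True by simp
  next
    case False
    then have "k \<le> card (N i \<inter> X)" using i by (auto simp: D_def)
    also have "\<dots> \<le> card (N i \<inter> Y)" using finY by (intro card_mono) (auto simp: Y_def)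
    finally show ?thesis .
  qed
  moreover have "card Y \<le> card X + k * card D"
  proof -
    have "finite D" using assms(1) by (simp add: D_def)
    have "card Y \<le> card X + card (\<Union>i\<in>D. S i)" unfolding Y_def by (rule card_Un_le)
    also have "card (\<Union>i\<in>D. S i) \<le> (\<Sum>i\<in>D. card (S i))"
      using \<open>finite D\<close> by (rule card_UN_le)
    also have "\<dots> = k * card D" using S by simp
    finally show ?thesis by simp
  qed
  ultimately show ?thesis using that YV unfolding D_def by blast
qed

text \<open>
  The quantity averaged is \<open>card X\<close> plus \<open>k\<close> times \<open>z ^ card (N i \<inter> X) / z ^ k\<close> for every \<open>i\<close>. It
  dominates the size of the repaired set, as \<open>z ^ j / z ^ k \<ge> 1\<close> for \<open>j < k\<close>.
\<close>
lemma exists_small_multicover: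
  fixes p z :: real
  assumes "finite I" and "finite V" and "0 \<le> p" and "p \<le> 1" and "0 < z" and "z \<le> 1"
    and sub: "\<And>i. i \<in> I \<Longrightarrow> N i \<subseteq> V"
    and big: "\<And>i. i \<in> I \<Longrightarrow> m \<le> card (N i)" and "k \<le> m"
  obtains Y where "Y \<subseteq> V" and "\<And>i. i \<in> I \<Longrightarrow> k \<le> card (N i \<inter> Y)"
    and "real (card Y)
      \<le> p * real (card V) + real k * ((1 - p * (1 - z)) ^ m / z ^ k) * real (card I)"
proof -
  define cost where
    "cost X = real (card X) + (\<Sum>i\<in>I. real k / z ^ k * z ^ card (N i \<inter> X))" for X
  obtain X where X: "X \<subseteq> V" and cost_X: "cost X \<le> bernoulli_mean V p cost"
    using exists_le_bernoulli_mean[OF assms(2-4)] .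
  obtain Y where Y: "Y \<subseteq> V" "\<And>i. i \<in> I \<Longrightarrow> k \<le> card (N i \<inter> Y)"
    and card_Y: "card Y \<le> card X + k * card {i \<in> I. card (N i \<inter> X) < k}"
    by (rule repair_deficient_sets[OF assms(1,2) X, of N k]) (use sub big \<open>k \<le> m\<close> in force)+
  have "real (card Y) \<le> real (card X) + real k * real (card {i \<in> I. card (N i \<inter> X) < k})"
    using card_Y by (metis of_nat_add of_nat_le_iff of_nat_mult)
  also have "real k * real (card {i \<in> I. card (N i \<inter> X) < k})
      = (\<Sum>i\<in>I. if card (N i \<inter> X) < k then real k else 0)"
    using assms(1) by (simp add: sum.If_cases Int_def)
  also have "\<dots> \<le> (\<Sum>i\<in>I. real k / z ^ k * z ^ card (N i \<inter> X))"
  proof (rule sum_mono)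
    fix i assume "i \<in> I"
    show "(if card (N i \<inter> X) < k then real k else 0) \<le> real k / z ^ k * z ^ card (N i \<inter> X)"
    proof (cases "card (N i \<inter> X) < k")
      case True
      then have "z ^ k \<le> z ^ card (N i \<inter> X)"
        using assms(5,6) by (intro power_decreasing) auto
      then have "real k * z ^ k \<le> real k * z ^ card (N i \<inter> X)"
        by (intro mult_left_mono) auto
      then show ?thesis using True assms(5) by (simp add: field_simps)
    qed (use assms(5) in auto)
  qed
  also have "real (card X) + \<dots> = cost X" by (simp add: cost_def)
  also note cost_X
  also have "bernoulli_mean V p cost
      = p * real (card V) + (\<Sum>i\<in>I. real k / z ^ k * (1 - p + p * z) ^ card (N i))"
    unfolding cost_def bernoulli_mean_add bernoulli_mean_sum bernoulli_mean_cmult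
    using sub by (simp add: bernoulli_mean_card bernoulli_mean_power_card_inter assms(2))
  also have "(\<Sum>i\<in>I. real k / z ^ k * (1 - p + p * z) ^ card (N i))
      \<le> (\<Sum>i\<in>I. real k / z ^ k * (1 - p * (1 - z)) ^ m)"
  proof (rule sum_mono)
    fix i assume i: "i \<in> I"
    have "p * (1 - z) \<le> 1 * 1" using assms(3-6) by (intro mult_mono) auto
    moreover have "0 \<le> p * (1 - z)" using assms(3,6) by simp
    ultimately have "(1 - p * (1 - z)) ^ card (N i) \<le> (1 - p * (1 - z)) ^ m"
      using big[OF i] by (intro power_decreasing) auto
    moreover have "1 - p + p * z = 1 - p * (1 - z)" by (simp add: algebra_simps)
    ultimately have "(1 - p + p * z) ^ card (N i) \<le> (1 - p * (1 - z)) ^ m"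
      by (simp only:)
    then show "real k / z ^ k * (1 - p + p * z) ^ card (N i)
        \<le> real k / z ^ k * (1 - p * (1 - z)) ^ m"
      using assms(5) by (intro mult_left_mono) auto
  qed
  also have "\<dots> = real k * ((1 - p * (1 - z)) ^ m / z ^ k) * real (card I)" by simp
  finally show ?thesis using that Y by simp
qed

section \<open>The Chernoff bound for the lower tail\<close>

text \<open>
  The difference of the two sides vanishes at \<open>0\<close> and has the derivative \<open>- ln (1 - c) - c \<ge> 0\<close>.
\<close>
lemma chernoff_exponent_ge:
  fixes c :: real
  assumes "0 \<le> c" and "c < 1"
  shows "c\<^sup>2 / 2 \<le> c + (1 - c) * ln (1 - c)"
proof -
  let ?f = "\<lambda>x::real. x + (1 - x) * ln (1 - x) - x\<^sup>2 / 2"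
  have "?f 0 \<le> ?f c"
  proof (rule DERIV_nonneg_imp_nondecreasing[OF assms(1)])
    fix x :: real assume x: "0 \<le> x" "x \<le> c"
    then have "x < 1" using assms(2) by simp
    then have "(?f has_real_derivative 1 + ((1 - x) * (- 1 / (1 - x)) - ln (1 - x)) - x) (at x)"
      by (auto intro!: derivative_eq_intros)
    then have "(?f has_real_derivative - ln (1 - x) - x) (at x)"
      using \<open>x < 1\<close> by simp
    moreover have "0 \<le> - ln (1 - x) - x"
      using ln_le_minus_one[of "1 - x"] \<open>x < 1\<close> by simp
    ultimately show "\<exists>y. (?f has_real_derivative y) (at x) \<and> 0 \<le> y" by blast
  qed
  then show ?thesis by simp
qed

text \<open>
  The left-hand side is the factor of \<open>k\<close> in \<open>exists_small_multicover\<close> for \<open>p = \<mu> / m\<close> and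
  \<open>z = 1 - c\<close>; this \<open>z\<close> minimises the exponent \<open>- \<mu> (1 - z) - (1 - c) \<mu> ln z\<close> that bounds it
  when \<open>k\<close> is as large as possible.
\<close>
lemma chernoff_factor_less:
  fixes c \<mu> :: real
  assumes "0 < c" and "c < 1" and "0 < \<mu>" and "\<mu> < real m" and "real k \<le> (1 - c) * \<mu>"
  shows "(1 - \<mu> / real m * c) ^ m / (1 - c) ^ k < exp (- (\<mu> * (c\<^sup>2 / 2)))"
proof -
  have m: "0 < m" using assms(3,4) by (cases m) auto
  have "\<mu> / real m * c < 1 * 1"
    using assms m by (intro mult_strict_mono) auto
  then have "(1 - \<mu> / real m * c) ^ m < exp (- (\<mu> / real m * c)) ^ m"
    using assms m by (intro power_strict_mono) (auto simp: exp_minus_greater)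
  also have "\<dots> = exp (- (\<mu> * c))"
    using m by (simp add: exp_of_nat_mult[symmetric])
  finally have "(1 - \<mu> / real m * c) ^ m / (1 - c) ^ k < exp (- (\<mu> * c)) / (1 - c) ^ k"
    using assms(2) by (intro divide_strict_right_mono) auto
  also have "exp (- (\<mu> * c)) / (1 - c) ^ k = exp (- (\<mu> * c) - real k * ln (1 - c))"
    using assms(2) by (simp add: exp_diff exp_of_nat_mult)
  also have "\<dots> \<le> exp (- (\<mu> * c) - (1 - c) * \<mu> * ln (1 - c))"
    using mult_right_mono_neg[OF assms(5), of "ln (1 - c)"] assms(1,2) by simp
  also have "\<dots> \<le> exp (- (\<mu> * (c\<^sup>2 / 2)))"
    using mult_left_mono[OF chernoff_exponent_ge[of c], of \<mu>] assms(1-3)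
    by (simp add: algebra_simps)
  finally show ?thesis .
qed

section \<open>Tuple domination in graphs\<close>

context pair_graph
begin

lemma closed_nbhd_subset:
  assumes "v \<in> pverts G"
  shows "closed_nbhd G v \<subseteq> pverts G"
  using assms in_arcsD2 by (auto simp: closed_nbhd_def)

lemma card_closed_nbhd: "card (closed_nbhd G v) = out_degree (with_proj G) v + 1"
proof -
  have arcs: "out_arcs (with_proj G) v = Pair v ` {u. (v, u) \<in> parcs G}"
    by (auto simp: out_arcs_def)
  have "out_degree (with_proj G) v = card {u. (v, u) \<in> parcs G}"
    unfolding out_degree_def arcs by (rule card_image) (simp add: inj_on_def)
  moreover have "finite {u. (v, u) \<in> parcs G}"
    by (rule finite_subset[OF _ pair_finite_verts]) (auto dest: in_arcsD2)
  moreover have "v \<notin> {u. (v, u) \<in> parcs G}" using pair_no_loops by force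
  ultimately show ?thesis by (simp add: closed_nbhd_def)
qed

lemma min_degree_less_card_closed_nbhd:
  assumes "v \<in> pverts G"
  shows "min_degree G + 1 \<le> card (closed_nbhd G v)"
  using assms pair_finite_verts by (simp add: card_closed_nbhd min_degree_def)

end

lemma tuple_domination_number_le:
  assumes "tuple_dominating_set k G X"
  shows "tuple_domination_number k G \<le> card X"
  unfolding tuple_domination_number_def using assms by (auto intro: Least_le)

text \<open>
  The lower bound on \<open>\<delta>\<close> is implicit: as \<open>k \<ge> 1\<close>, the hypothesis \<open>k \<le> (1 - c) ln \<delta>\<close> forces
  \<open>ln \<delta> > 0\<close>, and then \<open>k \<le> ln \<delta> < \<delta>\<close> makes every closed neighbourhood large enough.
\<close>
lemma tuple_domination_number_less:
  fixes c :: real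
  assumes c: "0 < c" "c < 1" and k: "1 \<le> k" and G: "pair_graph G" and ne: "pverts G \<noteq> {}"
    and \<delta>: "min_degree G = \<delta>" and k_le: "real k \<le> (1 - c) * ln (real \<delta>)"
  shows "real (tuple_domination_number k G)
    < (ln (real \<delta>) / (real \<delta> + 1) + real k / real \<delta> powr (0.5 * c\<^sup>2)) * real (card (pverts G))"
proof -
  interpret pair_graph G by fact
  define \<mu> p where "\<mu> = ln (real \<delta>)" and "p = \<mu> / real (\<delta> + 1)"
  have "0 < (1 - c) * \<mu>" using k k_le by (simp add: \<mu>_def)
  then have \<mu>: "0 < \<mu>" using c by (simp add: zero_less_mult_iff)
  then have pos: "0 < real \<delta>" by (cases "\<delta> = 0") (auto simp: \<mu>_def)
  have less: "\<mu> < real \<delta>" using pos by (simp add: \<mu>_def)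
  have p: "0 \<le> p" "p \<le> 1" using \<mu> less by (simp_all add: p_def)
  have "(1 - c) * \<mu> \<le> 1 * \<mu>" using c \<mu> by (intro mult_right_mono) auto
  then have "real k \<le> \<mu>" using k_le unfolding \<mu>_def by linarith
  then have "k \<le> \<delta> + 1" using less by simp
  then obtain Y where Y: "Y \<subseteq> pverts G"
      "\<And>v. v \<in> pverts G \<Longrightarrow> k \<le> card (closed_nbhd G v \<inter> Y)"
    and card_Y: "real (card Y) \<le> p * real (card (pverts G))
      + real k * ((1 - p * (1 - (1 - c))) ^ (\<delta> + 1) / (1 - c) ^ k) * real (card (pverts G))"
    using exists_small_multicover[of "pverts G" "pverts G" p "1 - c" "closed_nbhd G" "\<delta> + 1" k]
      pair_finite_verts p c closed_nbhd_subset min_degree_less_card_closed_nbhd \<delta> by auto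
  have "(1 - p * c) ^ (\<delta> + 1) / (1 - c) ^ k < exp (- (\<mu> * (c\<^sup>2 / 2)))"
    unfolding p_def
    by (rule chernoff_factor_less) (use c \<mu> less k_le in \<open>simp_all add: \<mu>_def\<close>)
  moreover have "0 < card (pverts G)" using ne pair_finite_verts by (simp add: card_gt_0_iff)
  ultimately have "real k * ((1 - p * c) ^ (\<delta> + 1) / (1 - c) ^ k) * real (card (pverts G))
      < real k * exp (- (\<mu> * (c\<^sup>2 / 2))) * real (card (pverts G))"
    using k by (intro mult_strict_right_mono mult_strict_left_mono) auto
  also have "exp (- (\<mu> * (c\<^sup>2 / 2))) = 1 / real \<delta> powr (0.5 * c\<^sup>2)"
    using pos by (simp add: powr_def \<mu>_def exp_minus field_simps)
  finally have "real (card Y) < p * real (card (pverts G))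
      + real k * (1 / real \<delta> powr (0.5 * c\<^sup>2)) * real (card (pverts G))"
    using card_Y by simp
  also have "\<dots> = (\<mu> / (real \<delta> + 1) + real k / real \<delta> powr (0.5 * c\<^sup>2)) * real (card (pverts G))"
    by (simp add: p_def algebra_simps)
  finally have "real (card Y)
      < (\<mu> / (real \<delta> + 1) + real k / real \<delta> powr (0.5 * c\<^sup>2)) * real (card (pverts G))" .
  moreover have "tuple_domination_number k G \<le> card Y"
    using Y by (intro tuple_domination_number_le) (simp add: tuple_dominating_set_def)
  ultimately show ?thesis unfolding \<mu>_def by linarith
qed

theorem theorem12:
  fixes c :: real
  assumes "0 < c" and "c < 1"
  shows "\<exists>\<epsilon> :: nat \<Rightarrow> real. \<epsilon> \<longlonglongrightarrow> 0 \<and>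
    (\<forall>k n \<delta> :: nat. \<forall>G :: 'a pair_pre_digraph.
      1 \<le> k \<longrightarrow> pair_graph G \<longrightarrow> pverts G \<noteq> {} \<longrightarrow>
      card (pverts G) = n \<longrightarrow> min_degree G = \<delta> \<longrightarrow>
      real k \<le> (1 - c) * ln (real \<delta>) \<longrightarrow>
        real (tuple_domination_number k G)
          < (ln (real \<delta>) / (real \<delta> + 1) + real k / real \<delta> powr (0.5 * c\<^sup>2)) * real n \<and>
        (ln (real \<delta>) / (real \<delta> + 1) + real k / real \<delta> powr (0.5 * c\<^sup>2)) * real n
          \<le> (1 - c) * ln (real \<delta>) / real \<delta> powr (0.5 * c\<^sup>2) * real n * (1 + \<epsilon> \<delta>))"
proof -
  define a where "a = 0.5 * c\<^sup>2"
  \<comment> \<open>The quotient of \<open>ln \<delta> / (\<delta> + 1)\<close> by \<open>A\<close>, the main term of the upper bound below.\<close>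
  define \<epsilon> :: "nat \<Rightarrow> real" where "\<epsilon> \<delta> = real \<delta> powr a / ((1 - c) * (real \<delta> + 1))" for \<delta>
  have "c\<^sup>2 < 1" using assms by (simp add: power_less_one_iff)
  then have a: "0 < a" "a < 1" using assms by (simp_all add: a_def)
  have lim: "\<epsilon> \<longlonglongrightarrow> 0"
    unfolding \<epsilon>_def using assms a by real_asymp
  have "real (tuple_domination_number k G)
          < (ln (real \<delta>) / (real \<delta> + 1) + real k / real \<delta> powr a) * real n \<and>
        (ln (real \<delta>) / (real \<delta> + 1) + real k / real \<delta> powr a) * real n
          \<le> (1 - c) * ln (real \<delta>) / real \<delta> powr a * real n * (1 + \<epsilon> \<delta>)"
    if k: "1 \<le> k" and G: "pair_graph G" "pverts G \<noteq> {}" "card (pverts G) = n" "min_degree G = \<delta>"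
      and k_le: "real k \<le> (1 - c) * ln (real \<delta>)"
    for k n \<delta> :: nat and G :: "'a pair_pre_digraph"
  proof
    show "real (tuple_domination_number k G)
        < (ln (real \<delta>) / (real \<delta> + 1) + real k / real \<delta> powr a) * real n"
      using tuple_domination_number_less[OF assms k G(1,2,4) k_le] G(3) by (simp add: a_def)
    have "\<delta> \<noteq> 0" using k k_le by (cases "\<delta> = 0") auto
    then have pos: "0 < real \<delta> powr a" by simp
    define A where "A = (1 - c) * ln (real \<delta>) / real \<delta> powr a"
    have "ln (real \<delta>) / (real \<delta> + 1) = A * \<epsilon> \<delta>"
      using pos assms by (simp add: A_def \<epsilon>_def)
    moreover have "real k / real \<delta> powr a \<le> A"
      unfolding A_def using k_le pos by (intro divide_right_mono) auto
    ultimately have "(ln (real \<delta>) / (real \<delta> + 1) + real k / real \<delta> powr a) * real n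
        \<le> (A * \<epsilon> \<delta> + A) * real n"
      by (intro mult_right_mono) auto
    also have "\<dots> = A * real n * (1 + \<epsilon> \<delta>)"
      by (simp add: algebra_simps)
    finally show "(ln (real \<delta>) / (real \<delta> + 1) + real k / real \<delta> powr a) * real n
        \<le> (1 - c) * ln (real \<delta>) / real \<delta> powr a * real n * (1 + \<epsilon> \<delta>)"
      unfolding A_def .
  qed
  then show ?thesis using lim unfolding a_def by blast
qed

end
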